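(* Let $\Omega\in(0,\pi)$, and let $\mathcal{X}_L$, $\mathcal{X}_H$, $\mathcal{K}_0$, $\widehat{\mathcal{K}}$ be as defined in the context. For every $k\in\mathcal{K}_0$ there exist sequences of predicting kernels $\{\widehat k_{L,m}\}_{m=1}^\infty\subset\widehat{\mathcal{K}}$ and $\{\widehat k_{H,m}\}_{m=1}^\infty\subset\widehat{\mathcal{K}}$ (depending only on $k$ and $\Omega$) such that for every process $x$ that is decomposed as $x(t)=x_L(t)+x_H(t)$ with $x_L\in\mathcal{X}_L$ and $x_H\in\mathcal{X}_H$, setting $$y(t)=\sum_{s=t}^{+\infty}k(t-s)x(s),\qquad y_L(t)=\sum_{s=t}^{+\infty}k(t-s)x_L(s),\qquad y_H(t)=\sum_{s=t}^{+\infty}k(t-s)x_H(s),$$ $$\widehat y_{L,m}(t)=\sum_{s=-\infty}^{t}\widehat k_{L,m}(t-s)x_L(s),\qquad \widehat y_{H,m}(t)=\sum_{s=-\infty}^{t}\widehat k_{H,m}(t-s)x_H(s),$$ one has, as $m\to+\infty$, $\|y_L-\widehat y_{L,m}\|_{\ell_2}\to0$ and $\|y_H-\widehat y_{H,m}\|_{\ell_2}\to0$, and the process $\widehat y_m(t)=\widehat y_{L,m}(t)+\widehat y_{H,m}(t)$ satisfies $\|y-\widehat y_m\|_{\ell_2}\to0$.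
   Context: Sequences. For $r\in[1,\infty)$, $\ell_r$ is the set of all two-sided sequences $x=\{x(t)\}_{t=-\infty}^{\infty}\subset\mathbb{C}$ with $\|x\|_{\ell_r}=\left(\sum_{t=-\infty}^\infty|x(t)|^r\right)^{1/r}<+\infty$; $\ell_\infty$ is the set of those with $\|x\|_{\ell_\infty}=\sup_t|x(t)|<+\infty$. $\ell_r^+$ is the set of $x\in\ell_r$ with $x(t)=0$ for $t=-1,-2,-3,\dots$. Z-transform. $X=\mathcal{Z}x$ is $X(z)=\sum_{t=-\infty}^{\infty}x(t)z^{-t}$. If $x\in\ell_2$, the restriction of $X$ to the unit circle is an element of $L_2$ of the circle. Hardy spaces. Let $D^c=\{z\in\mathbb{C}:|z|>1\}$. $H^r$ is the Hardy space of functions holomorphic on $D^c$ including the point at infinity. Process classes. For the given $\Omega\in(0,\pi)$ (with $\omega\in[-\pi,\pi]$ and $X=\mathcal{Z}x$), $\mathcal{X}_L=\{x\in\ell_2:\ X(e^{i\omega})=0\text{ if }|\omega|>\Omega\}$ and $\mathcal{X}_H=\{x\in\ell_2:\ X(e^{i\omega})=0\text{ if }|\omega|<\Omega\}$ (equalities for a.e. such $\omega$). Kernel classes. $\mathcal{K}_0$ is the class of all $k\in\ell_\infty$ such that $k(t)=0$ for $t>0$ and $K=\mathcal{Z}k$ can be represented as $K(z)=\frac{z+b}{z+a}$ for some real $a\in(-\infty,-1)\cup(1,+\infty)$ and $b\in\mathbb{R}$. $\widehat{\mathcal{K}}$ is the class of all $\widehat k\in\ell_\infty^+$ such that $\widehat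 K=\mathcal{Z}\widehat k$ belongs to $H^\infty\cap H^2$. The interpretation is that the values $x_L(s)$ and $x_H(s)$ for $s\le t$ are available to the observer at time $t$ (ideal low-pass and high-pass filters exist for the process), so that $\widehat y_m(t)$ is a prediction of $y(t)$ using historical observations only. *)

theory Defs
  imports "HOL-Complex_Analysis.Complex_Analysis"
begin

type_synonym cseq = "int \<Rightarrow> complex"

definition ell :: "real \<Rightarrow> cseq set" where
  "ell r = {x. (\<lambda>t. norm (x t) powr r) summable_on UNIV}"

text \<open>The norm is only meaningful on \<^term>\<open>ell r\<close>: a divergent sum has the value 0.\<close>

definition ell_norm :: "real \<Rightarrow> cseq \<Rightarrow> real" where
  "ell_norm r x = (\<Sum>\<^sub>\<infinity>t. norm (x t) powr r) powr (1 / r)"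

definition ell_inf :: "cseq set" where
  "ell_inf = {x. bounded (range x)}"

definition ell_inf_plus :: "cseq set" where
  "ell_inf_plus = {x \<in> ell_inf. \<forall>t<0. x t = 0}"

definition ztransform :: "cseq \<Rightarrow> complex \<Rightarrow> complex" where
  "ztransform x z = (\<Sum>\<^sub>\<infinity>t. x t * z powi (- t))"

text \<open>
  For a square-summable \<open>x\<close> the series need not converge absolutely on the unit circle.
  There the Z-transform is the limit, in the mean square sense, of its symmetric partial sums.
  It is written as a function \<open>X\<close> of the angle \<open>\<omega>\<close>, standing for
  \<open>X(e^(i \<omega>))\<close>, and is determined almost everywhere.
\<close>

definition L2_circle :: "(real \<Rightarrow> complex) set" where
  "L2_circle = {X \<in> borel_measurable (lebesgue_on {-pi..pi}).
     integrable (lebesgue_on {-pi..pi}) (\<lambda>\<omega>. (norm (X \<omega>))\<^sup>2)}"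

definition has_ztransform_circle :: "cseq \<Rightarrow> (real \<Rightarrow> complex) \<Rightarrow> bool" where
  "has_ztransform_circle x X \<longleftrightarrow> X \<in> L2_circle \<and>
     (\<lambda>N. LINT \<omega>|lebesgue_on {-pi..pi}.
        (norm (X \<omega> - (\<Sum>t = - int N..int N. x t * cis \<omega> powi (- t))))\<^sup>2) \<longlonglongrightarrow> 0"

definition low_band :: "real \<Rightarrow> cseq set" where
  "low_band \<Omega> = {x \<in> ell 2. \<exists>X. has_ztransform_circle x X \<and>
     (AE \<omega> in lebesgue_on {-pi..pi}. \<bar>\<omega>\<bar> > \<Omega> \<longrightarrow> X \<omega> = 0)}"

definition high_band :: "real \<Rightarrow> cseq set" where
  "high_band \<Omega> = {x \<in> ell 2. \<exists>X. has_ztransform_circle x X \<and>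
     (AE \<omega> in lebesgue_on {-pi..pi}. \<bar>\<omega>\<bar> < \<Omega> \<longrightarrow> X \<omega> = 0)}"

text \<open>Holomorphic on \<open>|z| > 1\<close> including the point at infinity, in the coordinate \<open>1/z\<close>.\<close>

definition holomorphic_exterior :: "(complex \<Rightarrow> complex) \<Rightarrow> bool" where
  "holomorphic_exterior F \<longleftrightarrow>
     (\<exists>G. G holomorphic_on ball 0 1 \<and> (\<forall>z. norm z > 1 \<longrightarrow> F z = G (1 / z)))"

definition Hardy :: "real \<Rightarrow> (complex \<Rightarrow> complex) set" where
  "Hardy r = {F. holomorphic_exterior F \<and>
     bdd_above ((\<lambda>\<rho>. integral {-pi..pi} (\<lambda>\<omega>. norm (F (of_real \<rho> * cis \<omega>)) powr r)) ` {1<..})}"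

definition Hardy_inf :: "(complex \<Rightarrow> complex) set" where
  "Hardy_inf = {F. holomorphic_exterior F \<and> bounded (F ` {z. norm z > 1})}"

text \<open>
  A bounded sequence vanishing at positive times has a Z-transform that is a power series in
  \<open>z\<close>, absolutely convergent on the open unit disc; the representation as a rational function
  is required there, which determines the sequence.
\<close>

definition anticausal_kernels :: "cseq set" where
  "anticausal_kernels = {k \<in> ell_inf. (\<forall>t>0. k t = 0) \<and>
     (\<exists>a b :: real. a \<in> {..<-1} \<union> {1<..} \<and>
        (\<forall>z. norm z < 1 \<longrightarrow> ztransform k z = (z + of_real b) / (z + of_real a)))}"

definition predicting_kernels :: "cseq set" where
  "predicting_kernels = {k \<in> ell_inf_plus. ztransform k \<in> Hardy_inf \<inter> Hardy 2}"

definition future_conv :: "cseq \<Rightarrow> cseq \<Rightarrow> cseq" where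
  "future_conv k x t = (\<Sum>\<^sub>\<infinity>s\<in>{t..}. k (t - s) * x s)"

definition past_conv :: "cseq \<Rightarrow> cseq \<Rightarrow> cseq" where
  "past_conv k x t = (\<Sum>\<^sub>\<infinity>s\<in>{..t}. k (t - s) * x s)"

definition future_conv_defined :: "cseq \<Rightarrow> cseq \<Rightarrow> bool" where
  "future_conv_defined k x \<longleftrightarrow> (\<forall>t. (\<lambda>s. k (t - s) * x s) summable_on {t..})"

definition past_conv_defined :: "cseq \<Rightarrow> cseq \<Rightarrow> bool" where
  "past_conv_defined k x \<longleftrightarrow> (\<forall>t. (\<lambda>s. k (t - s) * x s) summable_on {..t})"

text \<open>
  Convergence to 0 of \<open>ell_norm r (u - v m)\<close>, \<open>m = 1, 2, \<dots>\<close>, with the membership that makes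
  these norms meaningful.
\<close>

definition tends_in_ell :: "real \<Rightarrow> (nat \<Rightarrow> cseq) \<Rightarrow> cseq \<Rightarrow> bool" where
  "tends_in_ell r v u \<longleftrightarrow> (\<forall>m\<ge>1. (\<lambda>t. u t - v m t) \<in> ell r) \<and>
     (\<lambda>m. ell_norm r (\<lambda>t. u t - v m t)) \<longlonglongrightarrow> 0"

end

theory Submission
  imports Defs "HOL-Real_Asymp.Real_Asymp"
begin

text \<open>
  A past-observation predictor with a finitely supported kernel has on the unit circle a transfer function that is a
  polynomial in \<open>w = 1/z\<close>, and every such polynomial occurs (\<open>fir_predicting\<close>). The kernel \<open>k\<close> to be
  imitated has the transfer function \<open>R w = (1 + b w) / (1 + a w)\<close>, whose pole \<open>- 1 / a\<close> is inside the
  unit disc. It cannot be approximated by polynomials on the whole circle, unless the pole cancels, but it can on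
  a proper arc, because the complement of the arc is connected. The spectrum of a low-pass process lives
  on an arc that misses a neighbourhood of \<open>- 1\<close>, that of a high-pass process on an arc that misses a
  neighbourhood of \<open>1\<close>; so each of the two components can be predicted by kernels of its own.

  The approximation is the elementary case of Runge's theorem that is needed here: the pole is moved
  through the gap in the arc to a point outside the closed disc by means of a Neumann series
  (\<open>poly_approx_cauchy_kernel\<close>).

  Uniform approximation of transfer functions on the spectral support turns into mean square approximation of the
  outputs by Parseval's identity. For a process whose Z-transform \<open>X\<close> is supported by \<open>S\<close>, the error energy is at
  most \<open>sup\<^sub>S |R - p|\<^sup>2\<close> times a constant multiple of the energy of \<open>X\<close>
  (\<open>finite_convolution_bound\<close>, \<open>prediction_error_bound\<close>). The polynomials do not depend on the process, and the
  bound for the sum of the two components follows from those for each of them.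
\<close>

section \<open>Finite filters and Parseval's identity\<close>

text \<open>
  The frequency response of the finitely supported filter that agrees with \<open>h\<close> on \<open>J\<close>. With
  \<open>J = {-N..N}\<close> it is also the partial sum of the Z-transform on the circle.
\<close>

definition symbol :: "int set \<Rightarrow> cseq \<Rightarrow> real \<Rightarrow> complex" where
  "symbol J h \<omega> = (\<Sum>j\<in>J. h j * cis \<omega> powi (- j))"

abbreviation circle_measure :: "real measure" where
  "circle_measure \<equiv> lebesgue_on {-pi..pi}"

lemma continuous_on_symbol [continuous_intros]:
  "continuous_on A (symbol J h)"
  unfolding symbol_def cis_power_int by (intro continuous_intros)

lemma integral_cis_circle:
  "(LINT \<omega>|circle_measure. cis (of_int n * \<omega>)) = (if n = 0 then 2 * pi else 0)"
proof (cases "n = 0")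
  case True
  then show ?thesis by (simp add: measure_restrict_space scaleR_conv_of_real)
next
  case False
  define g where "g \<omega> = cis (of_int n * \<omega>) / (\<i> * of_int n)" for \<omega>
  have "((\<lambda>\<omega>. cis (of_int n * \<omega>)) has_integral (g pi - g (- pi))) {-pi..pi}"
  proof (rule fundamental_theorem_of_calculus)
    fix \<omega> assume "\<omega> \<in> {-pi..pi}"
    have "((\<lambda>z. exp (\<i> * (of_int n * z)) / (\<i> * of_int n)) has_field_derivative
        exp (\<i> * (of_int n * of_real \<omega>))) (at (of_real \<omega>))"
      using False by (auto intro!: derivative_eq_intros simp: mult.commute[of _ \<i>])
    from has_vector_derivative_real_field[OF this]
    show "(g has_vector_derivative cis (of_int n * \<omega>)) (at \<omega> within {-pi..pi})"
      by (simp add: g_def[abs_def] cis_conv_exp)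
  qed simp
  moreover have "g pi = g (- pi)"
  proof -
    have "cis (of_int n * pi) = cis (of_int n * - pi)"
      using sin_npi_int[of n] by (simp add: complex_eq_iff mult.commute)
    then show ?thesis by (simp only: g_def)
  qed
  ultimately have "integral {-pi..pi} (\<lambda>\<omega>. cis (of_int n * \<omega>)) = 0"
    by (simp add: integral_unique)
  moreover have "integrable circle_measure (\<lambda>\<omega>. cis (of_int n * \<omega>))"
    by (intro continuous_imp_integrable_real continuous_intros)
  ultimately show ?thesis
    using False by (subst lebesgue_integral_eq_integral) auto
qed

lemma parseval_symbol:
  assumes "finite T"
  shows "(LINT \<omega>|circle_measure. (norm (symbol T c \<omega>))\<^sup>2) = 2 * pi * (\<Sum>t\<in>T. (norm (c t))\<^sup>2)"
proof -
  have int: "integrable circle_measure (\<lambda>\<omega>. c s * cnj (c t) * cis (of_int (t - s) * \<omega>))" for s t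
    by (intro continuous_imp_integrable_real continuous_intros)
  have "complex_of_real (LINT \<omega>|circle_measure. (norm (symbol T c \<omega>))\<^sup>2)
      = (LINT \<omega>|circle_measure. of_real ((norm (symbol T c \<omega>))\<^sup>2))"
    by (rule integral_complex_of_real[symmetric])
  also have "\<dots> = (LINT \<omega>|circle_measure. (\<Sum>s\<in>T. \<Sum>t\<in>T. c s * cnj (c t) * cis (of_int (t - s) * \<omega>)))"
  proof (rule Bochner_Integration.integral_cong[OF refl])
    fix \<omega>
    have "cis (- (of_int s * \<omega>)) * cis (of_int t * \<omega>) = cis (of_int (t - s) * \<omega>)" for s t :: int
      by (simp add: cis_mult algebra_simps)
    then show "of_real ((norm (symbol T c \<omega>))\<^sup>2)
      = (\<Sum>s\<in>T. \<Sum>t\<in>T. c s * cnj (c t) * cis (of_int (t - s) * \<omega>))"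
      unfolding complex_norm_square symbol_def cis_power_int
      by (simp add: cis_cnj sum_product mult.assoc mult.left_commute[of "cis _"])
  qed
  also have "\<dots> = (\<Sum>s\<in>T. \<Sum>t\<in>T. c s * cnj (c t) * (if t - s = 0 then 2 * pi else 0))"
    by (simp add: int integral_cis_circle del: of_int_diff cong: if_cong)
  also have "\<dots> = (\<Sum>s\<in>T. \<Sum>t\<in>T. if s = t then c s * cnj (c s) * (2 * pi) else 0)"
    by (intro sum.cong) auto
  also have "\<dots> = (\<Sum>s\<in>T. c s * cnj (c s) * (2 * pi))"
    using assms by (simp add: sum.delta)
  also have "\<dots> = of_real (2 * pi * (\<Sum>t\<in>T. (norm (c t))\<^sup>2))"
    by (simp add: complex_norm_square[symmetric] sum_distrib_left mult_ac flip: of_real_power)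
  finally show ?thesis
    using of_real_eq_iff by blast
qed

lemma symbol_mult_symbol:
  fixes N R :: int
  assumes "J \<subseteq> {-R..R}"
  shows "symbol J h \<omega> * symbol {-N..N} x \<omega>
    = symbol {-(N+R)..N+R} (\<lambda>u. \<Sum>j\<in>J. h j * (if \<bar>u - j\<bar> \<le> N then x (u - j) else 0)) \<omega>"
proof -
  let ?e = "\<lambda>n::int. cis (- (of_int n * \<omega>))"
  let ?U = "{-(N+R)..N+R}"
  have shift: "(\<Sum>u\<in>?U. (if \<bar>u - j\<bar> \<le> N then x (u - j) else 0) * ?e u) = (\<Sum>s\<in>{-N..N}. x s * ?e s) * ?e j"
    if "j \<in> J" for j
  proof -
    have "j \<in> {-R..R}" using that assms by blast
    then have j: "\<bar>j\<bar> \<le> R" by (simp add: abs_le_iff)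
    have "(\<Sum>u\<in>?U. (if \<bar>u - j\<bar> \<le> N then x (u - j) else 0) * ?e u)
        = (\<Sum>u\<in>{u\<in>?U. \<bar>u - j\<bar> \<le> N}. x (u - j) * ?e u)"
      by (intro sum.mono_neutral_cong_right) auto
    also have "\<dots> = (\<Sum>s\<in>{-N..N}. x s * ?e (s + j))"
      by (rule sum.reindex_bij_witness[of _ "\<lambda>s. s + j" "\<lambda>u. u - j"]) (use j in auto)
    finally have "(\<Sum>u\<in>?U. (if \<bar>u - j\<bar> \<le> N then x (u - j) else 0) * ?e u)
        = (\<Sum>s\<in>{-N..N}. x s * ?e (s + j))" .
    moreover have "?e (s + j) = ?e s * ?e j" for s
      by (simp add: cis_mult algebra_simps)
    ultimately show ?thesis
      by (simp add: sum_distrib_right mult.assoc)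
  qed
  have "symbol ?U (\<lambda>u. \<Sum>j\<in>J. h j * (if \<bar>u - j\<bar> \<le> N then x (u - j) else 0)) \<omega>
     = (\<Sum>j\<in>J. h j * (\<Sum>u\<in>?U. (if \<bar>u - j\<bar> \<le> N then x (u - j) else 0) * ?e u))"
    unfolding symbol_def cis_power_int sum_distrib_right sum_distrib_left
    by (subst sum.swap) (simp add: mult.assoc)
  also have "\<dots> = (\<Sum>j\<in>J. h j * ((\<Sum>s\<in>{-N..N}. x s * ?e s) * ?e j))"
    using shift by (intro sum.cong refl) auto
  also have "\<dots> = symbol J h \<omega> * symbol {-N..N} x \<omega>"
    unfolding symbol_def cis_power_int sum_distrib_right[of _ J]
    by (intro sum.cong) (auto simp: mult_ac)
  finally show ?thesis by simp
qed

lemma norm_sq_le_double: "(norm (u :: 'a :: real_normed_vector))\<^sup>2 \<le> 2 * (norm v)\<^sup>2 + 2 * (norm (v - u))\<^sup>2"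
proof -
  have "norm u \<le> norm v + norm (v - u)"
    by (metis add.commute norm_minus_commute norm_triangle_sub)
  then have "(norm u)\<^sup>2 \<le> (norm v + norm (v - u))\<^sup>2"
    by (intro power_mono) auto
  also have "\<dots> \<le> 2 * (norm v)\<^sup>2 + 2 * (norm (v - u))\<^sup>2"
    using sum_squares_bound[of "norm v" "norm (v - u)"] by (simp add: power2_sum)
  finally show ?thesis .
qed

text \<open>
  Only the values of the frequency response on the spectral support \<open>S\<close> of \<open>x\<close> count. For the
  truncation of \<open>x\<close> to \<open>[-N, N]\<close> the output is finitely supported, so that Parseval's identity
  for trigonometric polynomials gives its energy as the mean square of \<open>H X\<^sub>N\<close>; and
  \<open>X\<^sub>N\<close> tends to \<open>X\<close> in mean square. A finite window \<open>F\<close> sees the true output as soon as \<open>N\<close>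
  is large. Splitting \<open>|H X\<^sub>N|\<^sup>2 \<le> 2 |H X|\<^sup>2 + 2 |H (X - X\<^sub>N)|\<^sup>2\<close> costs a factor 2 against the
  sharp constant and makes the limit immediate.
\<close>

lemma finite_convolution_bound:
  assumes "finite J" and "has_ztransform_circle x X"
    and supp: "AE \<omega> in circle_measure. \<omega> \<notin> S \<longrightarrow> X \<omega> = 0"
    and \<beta>: "\<And>\<omega>. \<omega> \<in> S \<Longrightarrow> norm (symbol J h \<omega>) \<le> \<beta>"
    and "finite F"
  shows "(\<Sum>t\<in>F. (norm (\<Sum>j\<in>J. h j * x (t - j)))\<^sup>2)
    \<le> \<beta>\<^sup>2 / pi * (LINT \<omega>|circle_measure. (norm (X \<omega>))\<^sup>2)"
proof -
  define H where "H = symbol J h"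
  define XN where "XN N = symbol {-int N..int N} x" for N
  define e where "e N = (LINT \<omega>|circle_measure. (norm (X \<omega> - XN N \<omega>))\<^sup>2)" for N
  define I where "I = (LINT \<omega>|circle_measure. (norm (X \<omega>))\<^sup>2)"
  define s where "s = (\<Sum>t\<in>F. (norm (\<Sum>j\<in>J. h j * x (t - j)))\<^sup>2)"
  have e0: "e \<longlonglongrightarrow> 0" and Xm: "X \<in> borel_measurable circle_measure"
    and X2: "integrable circle_measure (\<lambda>\<omega>. (norm (X \<omega>))\<^sup>2)"
    using assms(2) unfolding has_ztransform_circle_def L2_circle_def e_def XN_def symbol_def by auto
  have "compact (H ` {-pi..pi})"
    unfolding H_def by (intro compact_continuous_image continuous_intros) auto
  then obtain B where B: "norm (H \<omega>) \<le> B" if "\<omega> \<in> {-pi..pi}" for \<omega>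
    by (meson bounded_iff compact_imp_bounded imageI)
  have [measurable]: "XN N \<in> borel_measurable circle_measure" for N
    unfolding XN_def by (intro continuous_imp_measurable_on_sets_lebesgue continuous_intros) auto
  have diff: "integrable circle_measure (\<lambda>\<omega>. (norm (X \<omega> - XN N \<omega>))\<^sup>2)" for N
  proof (rule Bochner_Integration.integrable_bound)
    have "integrable circle_measure (\<lambda>\<omega>. (norm (XN N \<omega>))\<^sup>2)"
      unfolding XN_def by (intro continuous_imp_integrable_real continuous_intros)
    then show "integrable circle_measure (\<lambda>\<omega>. 2 * (norm (X \<omega>))\<^sup>2 + 2 * (norm (XN N \<omega>))\<^sup>2)"
      using X2 by simp
    show "(\<lambda>\<omega>. (norm (X \<omega> - XN N \<omega>))\<^sup>2) \<in> borel_measurable circle_measure"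
      using Xm by measurable
    show "AE \<omega> in circle_measure. norm ((norm (X \<omega> - XN N \<omega>))\<^sup>2)
        \<le> norm (2 * (norm (X \<omega>))\<^sup>2 + 2 * (norm (XN N \<omega>))\<^sup>2)"
      using norm_sq_le_double[of "X \<omega> - XN N \<omega>" "X \<omega>" for \<omega>] by (intro AE_I2) simp
  qed
  \<comment> \<open>For these \<open>N\<close> the truncation of \<open>x\<close> does not change the output inside \<open>F\<close>.\<close>
  have bound: "2 * pi * s \<le> 2 * \<beta>\<^sup>2 * I + 2 * B\<^sup>2 * e N"
    if N: "\<And>t j. t \<in> F \<Longrightarrow> j \<in> J \<Longrightarrow> \<bar>t - j\<bar> \<le> int N" for N
  proof -
    obtain R0 where R0: "\<And>j. j \<in> J \<Longrightarrow> \<bar>j\<bar> \<le> R0"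
      using Max_ge[OF finite_imageI[OF assms(1)]] by (meson imageI)
    obtain R1 where R1: "\<And>j. j \<in> F \<Longrightarrow> \<bar>j\<bar> \<le> R1"
      using Max_ge[OF finite_imageI[OF assms(5)]] by (meson imageI)
    define R where "R = max R0 R1"
    have R: "J \<subseteq> {-R..R}" "F \<subseteq> {-(int N+R)..int N+R}"
      using R0 R1 unfolding R_def by fastforce+
    define c where "c u = (\<Sum>j\<in>J. h j * (if \<bar>u - j\<bar> \<le> int N then x (u - j) else 0))" for u
    have "s = (\<Sum>t\<in>F. (norm (c t))\<^sup>2)"
      unfolding s_def c_def using N by (intro sum.cong refl arg_cong[where f = "\<lambda>u. (norm u)\<^sup>2"]) auto
    also have "\<dots> \<le> (\<Sum>t\<in>{-(int N+R)..int N+R}. (norm (c t))\<^sup>2)"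
      using R(2) by (intro sum_mono2) auto
    finally have "2 * pi * s \<le> (LINT \<omega>|circle_measure. (norm (symbol {-(int N+R)..int N+R} c \<omega>))\<^sup>2)"
      by (simp add: parseval_symbol)
    also have "\<dots> = (LINT \<omega>|circle_measure. (norm (H \<omega> * XN N \<omega>))\<^sup>2)"
      unfolding H_def XN_def c_def using symbol_mult_symbol[OF R(1)] by simp
    also have "\<dots> \<le> (LINT \<omega>|circle_measure. 2 * \<beta>\<^sup>2 * (norm (X \<omega>))\<^sup>2 + 2 * B\<^sup>2 * (norm (X \<omega> - XN N \<omega>))\<^sup>2)"
    proof (rule integral_mono_AE)
      show "integrable circle_measure (\<lambda>\<omega>. (norm (H \<omega> * XN N \<omega>))\<^sup>2)"
        unfolding H_def XN_def by (intro continuous_imp_integrable_real continuous_intros)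
      show "integrable circle_measure (\<lambda>\<omega>. 2 * \<beta>\<^sup>2 * (norm (X \<omega>))\<^sup>2 + 2 * B\<^sup>2 * (norm (X \<omega> - XN N \<omega>))\<^sup>2)"
        using X2 diff by simp
      have circ: "AE \<omega> in circle_measure. \<omega> \<in> {-pi..pi}"
        using AE_space[of circle_measure] by simp
      show "AE \<omega> in circle_measure. (norm (H \<omega> * XN N \<omega>))\<^sup>2
          \<le> 2 * \<beta>\<^sup>2 * (norm (X \<omega>))\<^sup>2 + 2 * B\<^sup>2 * (norm (X \<omega> - XN N \<omega>))\<^sup>2"
        using supp circ
      proof eventually_elim
        case (elim \<omega>)
        have "(norm (H \<omega> * X \<omega>))\<^sup>2 \<le> \<beta>\<^sup>2 * (norm (X \<omega>))\<^sup>2"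
        proof (cases "\<omega> \<in> S")
          case True
          then show ?thesis
            using \<beta>[OF True] by (auto simp: H_def norm_mult power_mult_distrib intro!: mult_right_mono power_mono)
        qed (use elim in simp)
        moreover have "(norm (H \<omega> * X \<omega> - H \<omega> * XN N \<omega>))\<^sup>2 \<le> B\<^sup>2 * (norm (X \<omega> - XN N \<omega>))\<^sup>2"
          using B[of \<omega>] elim
          by (auto simp: norm_mult power_mult_distrib intro!: mult_right_mono power_mono simp flip: right_diff_distrib)
        ultimately show ?case
          using norm_sq_le_double[of "H \<omega> * XN N \<omega>" "H \<omega> * X \<omega>"] by linarith
      qed
    qed
    also have "\<dots> = 2 * \<beta>\<^sup>2 * I + 2 * B\<^sup>2 * e N"
      unfolding I_def e_def using X2 diff by simp
    finally show ?thesis .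
  qed
  define L where "L = Max ((\<lambda>(t, j). \<bar>t - j\<bar>) ` (F \<times> J))"
  have L: "\<bar>t - j\<bar> \<le> L" if "t \<in> F" "j \<in> J" for t j
    unfolding L_def by (rule Max_ge) (use that assms in auto)
  have "eventually (\<lambda>N. 2 * pi * s \<le> 2 * \<beta>\<^sup>2 * I + 2 * B\<^sup>2 * e N) sequentially"
    using eventually_ge_at_top[of "nat L"]
  proof eventually_elim
    case (elim N)
    show ?case by (rule bound) (use L elim in force)
  qed
  moreover have "(\<lambda>N. 2 * \<beta>\<^sup>2 * I + 2 * B\<^sup>2 * e N) \<longlonglongrightarrow> 2 * \<beta>\<^sup>2 * I + 2 * B\<^sup>2 * 0"
    by (intro tendsto_intros e0)
  ultimately have "2 * pi * s \<le> 2 * \<beta>\<^sup>2 * I + 2 * B\<^sup>2 * 0"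
    by (intro tendsto_lowerbound[where F = sequentially]) auto
  then show ?thesis
    unfolding s_def I_def by (simp add: field_simps)
qed

section \<open>Polynomial approximation on arcs of the circle\<close>

definition poly_approx :: "complex set \<Rightarrow> (complex \<Rightarrow> complex) \<Rightarrow> bool" where
  "poly_approx A f \<longleftrightarrow> (\<forall>e>0. \<exists>p. \<forall>w\<in>A. norm (f w - poly p w) < e)"

lemma poly_approx_poly: "poly_approx A (poly p)"
  unfolding poly_approx_def by (intro allI impI exI[of _ p]) simp

lemma poly_approx_cong: "(\<And>w. w \<in> A \<Longrightarrow> f w = g w) \<Longrightarrow> poly_approx A f \<longleftrightarrow> poly_approx A g"
  unfolding poly_approx_def by simp

lemma poly_approx_limit:
  assumes "\<And>e. e > 0 \<Longrightarrow> \<exists>g. poly_approx A g \<and> (\<forall>w\<in>A. norm (f w - g w) < e)"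
  shows "poly_approx A f"
  unfolding poly_approx_def
proof (intro allI impI)
  fix e :: real assume "e > 0"
  then obtain g p where "\<forall>w\<in>A. norm (f w - g w) < e / 2" "\<forall>w\<in>A. norm (g w - poly p w) < e / 2"
    using assms[of "e / 2"] unfolding poly_approx_def by (metis half_gt_zero)
  then have "\<forall>w\<in>A. norm (f w - poly p w) < e"
    using norm_diff_triangle_less by fastforce
  then show "\<exists>p. \<forall>w\<in>A. norm (f w - poly p w) < e" ..
qed

lemma poly_approx_add:
  assumes "poly_approx A f" "poly_approx A g"
  shows "poly_approx A (\<lambda>w. f w + g w)"
  unfolding poly_approx_def
proof (intro allI impI)
  fix e :: real assume "e > 0"
  then obtain p q where "\<forall>w\<in>A. norm (f w - poly p w) < e / 2" "\<forall>w\<in>A. norm (g w - poly q w) < e / 2"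
    using assms unfolding poly_approx_def by (metis half_gt_zero)
  then have "\<forall>w\<in>A. norm (f w + g w - poly (p + q) w) < e"
    by (auto simp: add_diff_add intro: norm_triangle_lt dest!: bspec)
  then show "\<exists>p. \<forall>w\<in>A. norm (f w + g w - poly p w) < e" ..
qed

lemma bounded_poly_image: 
  fixes p :: "complex poly"
  assumes "bounded A" shows "bounded (poly p ` A)"
proof -
  have "compact (poly p ` closure A)"
    using assms by (intro compact_continuous_image continuous_intros) auto
  then show ?thesis
    by (meson bounded_subset closure_subset compact_imp_bounded image_mono)
qed

lemma poly_approx_mult:
  assumes "bounded A" and f: "poly_approx A f" and g: "poly_approx A g"
  shows "poly_approx A (\<lambda>w. f w * g w)"
  unfolding poly_approx_def
proof (intro allI impI)
  fix e :: real assume e: "e > 0"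
  obtain p0 where p0: "\<forall>w\<in>A. norm (f w - poly p0 w) < 1"
    using f unfolding poly_approx_def by (meson zero_less_one)
  obtain B0 where B0: "\<forall>w\<in>A. norm (poly p0 w) \<le> B0" "B0 > 0"
    using bounded_poly_image[OF assms(1)] unfolding bounded_pos by (metis imageI)
  define B where "B = B0 + 1"
  have B: "B > 0" using B0 by (simp add: B_def)
  have fB: "norm (f w) \<le> B" if "w \<in> A" for w
    using norm_triangle_sub[of "f w" "poly p0 w"] B0 p0 that unfolding B_def by fastforce
  have "e / (2 * B) > 0" using e B by simp
  then obtain q where q: "\<forall>w\<in>A. norm (g w - poly q w) < e / (2 * B)"
    using g unfolding poly_approx_def by blast
  obtain C where C: "\<forall>w\<in>A. norm (poly q w) \<le> C" "C > 0"
    using bounded_poly_image[OF assms(1)] unfolding bounded_pos by (metis imageI)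
  have "e / (2 * C) > 0" using e C by simp
  then obtain p where p: "\<forall>w\<in>A. norm (f w - poly p w) < e / (2 * C)"
    using f unfolding poly_approx_def by blast
  have "norm (f w * g w - poly (p * q) w) < e" if "w \<in> A" for w
  proof -
    have "norm (f w * g w - poly (p * q) w) = norm (f w * (g w - poly q w) + (f w - poly p w) * poly q w)"
      by (simp add: algebra_simps)
    also have "\<dots> \<le> norm (f w) * norm (g w - poly q w) + norm (f w - poly p w) * norm (poly q w)"
      by (metis norm_mult norm_triangle_ineq)
    also have "norm (f w) * norm (g w - poly q w) \<le> B * norm (g w - poly q w)"
      using fB that by (intro mult_right_mono) auto
    also have "\<dots> < B * (e / (2 * B))"
      using q that B by (intro mult_strict_left_mono) auto
    also have "\<dots> = e / 2" using B by simp
    also have "norm (f w - poly p w) * norm (poly q w) \<le> e / (2 * C) * C"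
      using p C that e by (intro mult_mono) (auto intro: less_imp_le)
    also have "\<dots> = e / 2" using C by simp
    finally show ?thesis by simp
  qed
  then show "\<exists>p. \<forall>w\<in>A. norm (f w * g w - poly p w) < e" by blast
qed

text \<open>
  The partial sums of the geometric series of \<open>h\<close> converge uniformly where \<open>|h| \<le> r < 1\<close>. This is
  the only source of functions that are not polynomials.
\<close>

lemma poly_approx_neumann:
  assumes "bounded A" and h: "poly_approx A h" and r: "r < 1" "\<And>w. w \<in> A \<Longrightarrow> norm (h w) \<le> r"
  shows "poly_approx A (\<lambda>w. 1 / (1 - h w))"
proof (rule poly_approx_limit)
  fix e :: real assume e: "e > 0"
  show "\<exists>g. poly_approx A g \<and> (\<forall>w\<in>A. norm (1 / (1 - h w) - g w) < e)"
  proof (cases "A = {}")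
    case False
    then have "0 \<le> r" using r(2) by (meson all_not_in_conv norm_ge_zero order_trans)
    have pow: "poly_approx A (\<lambda>w. h w ^ n)" for n
    proof (induction n)
      case 0
      show ?case using poly_approx_poly[of A 1] by (simp cong: poly_approx_cong)
    qed (simp add: poly_approx_mult assms)
    have part: "poly_approx A (\<lambda>w. \<Sum>i<n. h w ^ i)" for n
    proof (induction n)
      case 0
      show ?case using poly_approx_poly[of A 0] by (simp cong: poly_approx_cong)
    qed (simp add: poly_approx_add pow)
    have "(\<lambda>n. r ^ n / (1 - r)) \<longlonglongrightarrow> 0 / (1 - r)"
      using \<open>0 \<le> r\<close> r(1) by (intro tendsto_divide LIMSEQ_realpow_zero) auto
    then obtain n where n: "r ^ n / (1 - r) < e"
      using order_tendstoD(2)[of _ 0 sequentially e] e by (auto simp: eventually_sequentially)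
    have "norm (1 / (1 - h w) - (\<Sum>i<n. h w ^ i)) < e" if "w \<in> A" for w
    proof -
      have ne: "h w \<noteq> 1" using r(1) r(2)[OF that] by auto
      have "1 / (1 - h w) - (\<Sum>i<n. h w ^ i) = h w ^ n / (1 - h w)"
        using ne by (simp add: sum_gp_strict field_simps)
      also have "norm \<dots> \<le> r ^ n / (1 - r)"
        unfolding norm_divide norm_power
        using \<open>0 \<le> r\<close> r(1) r(2)[OF that] norm_triangle_ineq2[of 1 "h w"] by (intro frac_le power_mono) auto
      finally show ?thesis using n by simp
    qed
    with part show ?thesis by blast
  qed (auto intro: exI[of _ "poly 0"] poly_approx_poly)
qed

text \<open>
  The pole \<open>p\<close> lies inside the disc, but the arc has a gap around \<open>- \<sigma>\<close>, through which it can
  be moved to \<open>q = - \<sigma> (1 + \<epsilon>)\<close> just outside. The quotient \<open>g(w) = (w - p) / (w - q)\<close> has a real part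
  bounded away from 0 on the arc: for \<open>\<epsilon> = 0\<close> this real part is the constant \<open>(1 - \<sigma> p) / 2\<close>, and the
  gap allows a small positive \<open>\<epsilon>\<close>. Hence \<open>|1 - s g| \<le> r < 1\<close> for a small \<open>s > 0\<close>, and
  \<open>1 / (w - p) = s / (w - q) \<cdot> 1 / (1 - (1 - s g))\<close> is covered by two geometric series: this one, and that of
  \<open>1 / (w - q)\<close>, whose pole is outside the closed disc.
\<close>

lemma poly_approx_cauchy_kernel:
  fixes \<sigma> p \<eta> :: real
  assumes \<sigma>: "\<sigma> = 1 \<or> \<sigma> = -1" and p: "\<bar>p\<bar> < 1" and \<eta>: "\<eta> > 0"
    and A: "\<And>w. w \<in> A \<Longrightarrow> norm w = 1 \<and> \<eta> \<le> 1 + \<sigma> * Re w"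
  shows "poly_approx A (\<lambda>w. 1 / (w - of_real p))"
proof -
  have bA: "bounded A" unfolding bounded_iff using A by (auto intro: exI[of _ 1])
  \<comment> \<open>Small enough for the gap term \<open>(1 - |p|) \<eta> = 4 \<epsilon>\<close> to dominate the error, at most \<open>2 \<epsilon>\<close>, that moving \<open>q\<close> off the circle causes.\<close>
  define \<epsilon> where "\<epsilon> = (1 - \<bar>p\<bar>) * \<eta> / 4"
  have \<epsilon>: "\<epsilon> > 0" using p \<eta> by (simp add: \<epsilon>_def)
  define d where "d w = w + of_real (\<sigma> * (1 + \<epsilon>))" for w :: complex
  define G where "G = 2 / \<epsilon>"
  define \<kappa> where "\<kappa> = 2 * \<epsilon> / (2 + \<epsilon>)\<^sup>2"
  \<comment> \<open>Minimises the bound \<open>1 - 2 s \<kappa> + s\<^sup>2 G\<^sup>2\<close> for \<open>|1 - s g|\<^sup>2\<close>.\<close>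
  define s where "s = \<kappa> / G\<^sup>2"
  define g where "g w = (w - of_real p) / d w" for w
  have pos: "G > 0" "\<kappa> > 0" "s > 0" using \<epsilon> by (auto simp: G_def \<kappa>_def s_def)
  have d: "\<epsilon> \<le> norm (d w)" "norm (d w) \<le> 2 + \<epsilon>" if "w \<in> A" for w
  proof -
    have n: "norm (of_real (\<sigma> * (1 + \<epsilon>)) :: complex) = 1 + \<epsilon>"
      unfolding norm_of_real using \<sigma> \<epsilon> by (auto simp: abs_mult)
    show "norm (d w) \<le> 2 + \<epsilon>"
      using norm_triangle_ineq[of w "of_real (\<sigma> * (1 + \<epsilon>))"] A[OF that] unfolding d_def n by simp
    show "\<epsilon> \<le> norm (d w)"
      using norm_diff_ineq[of "of_real (\<sigma> * (1 + \<epsilon>))" w] A[OF that] unfolding d_def n by (simp add: add.commute)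
  qed
  have Re_g: "\<kappa> \<le> Re (g w)" if "w \<in> A" for w
  proof -
    have w: "(Re w)\<^sup>2 + (Im w)\<^sup>2 = 1" "\<eta> \<le> 1 + \<sigma> * Re w" "\<bar>Re w\<bar> \<le> 1"
      using A[OF that] abs_Re_le_cmod[of w] by (auto simp: cmod_power2[symmetric])
    have "Re ((w - of_real p) * cnj (d w)) = (1 - \<sigma> * p) * (1 + \<sigma> * Re w) + \<epsilon> * (\<sigma> * (Re w - p))"
      using \<sigma> w(1) by (auto simp: d_def algebra_simps power2_eq_square)
    moreover have "(1 - \<bar>p\<bar>) * \<eta> \<le> (1 - \<sigma> * p) * (1 + \<sigma> * Re w)"
      using \<sigma> w p \<eta> by (intro mult_mono) auto
    moreover have "\<epsilon> * (-2) \<le> \<epsilon> * (\<sigma> * (Re w - p))"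
      using \<sigma> w p \<epsilon> by (intro mult_left_mono) auto
    moreover have "(1 - \<bar>p\<bar>) * \<eta> = 4 * \<epsilon>"
      by (simp add: \<epsilon>_def)
    ultimately have num: "2 * \<epsilon> \<le> Re ((w - of_real p) * cnj (d w))"
      by linarith
    have "\<kappa> \<le> Re ((w - of_real p) * cnj (d w)) / (norm (d w))\<^sup>2"
      unfolding \<kappa>_def using num \<epsilon> d[OF that] by (intro frac_le power_mono zero_less_power) auto
    also have "\<dots> = Re (g w)"
      unfolding g_def complex_div_cnj[of "w - of_real p"]
      by (metis Re_divide_of_real of_real_power)
    finally show ?thesis .
  qed
  have norm_g: "norm (g w) \<le> G" if "w \<in> A" for w
  proof -
    have "norm (w - of_real p) \<le> 2"
      using norm_triangle_ineq4[of w "of_real p"] A[OF that] p by simp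
    then show ?thesis
      unfolding g_def G_def norm_divide using d[OF that] \<epsilon> by (intro frac_le) auto
  qed
  define r where "r = sqrt (1 - \<kappa>\<^sup>2 / G\<^sup>2)"
  have r: "norm (1 - of_real s * g w) \<le> r" if "w \<in> A" for w
  proof -
    have "(norm (1 - of_real s * g w))\<^sup>2 = 1 - 2 * s * Re (g w) + s\<^sup>2 * (norm (g w))\<^sup>2"
      unfolding cmod_power2 by (simp add: power2_eq_square algebra_simps)
    also have "\<dots> \<le> 1 - 2 * s * \<kappa> + s\<^sup>2 * G\<^sup>2"
      using Re_g[OF that] norm_g[OF that] pos by (intro add_mono diff_mono mult_left_mono power_mono) auto
    also have "\<dots> = 1 - \<kappa>\<^sup>2 / G\<^sup>2"
      using pos by (simp add: s_def field_simps power2_eq_square)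
    finally show ?thesis
      unfolding r_def by (rule real_le_rsqrt)
  qed
  have inv_d: "poly_approx A (\<lambda>w. 1 / d w)"
  proof -
    define D where "D = \<sigma> * (1 + \<epsilon>)"
    define h :: "complex \<Rightarrow> complex" where "h = poly [:0, of_real (- 1 / D):]"
    have D: "\<bar>D\<bar> = 1 + \<epsilon>" "D \<noteq> 0" using \<sigma> \<epsilon> by (auto simp: D_def)
    have "poly_approx A (\<lambda>w. 1 / (1 - h w))"
    proof (rule poly_approx_neumann[OF bA])
      show "poly_approx A h" unfolding h_def by (rule poly_approx_poly)
      show "1 / (1 + \<epsilon>) < 1" using \<epsilon> by simp
      show "norm (h w) \<le> 1 / (1 + \<epsilon>)" if "w \<in> A" for w
        using A[OF that] D by (simp add: h_def norm_mult norm_divide)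
    qed
    from poly_approx_mult[OF bA poly_approx_poly[of A "[:of_real (1 / D):]"] this]
    show ?thesis
    proof (rule iffD1[OF poly_approx_cong, rotated])
      fix w assume "w \<in> A"
      have "d w \<noteq> 0" using d[OF \<open>w \<in> A\<close>] \<epsilon> by auto
      moreover have "d w = of_real D * (1 - h w)"
        using D by (simp add: d_def h_def D_def[symmetric] field_simps)
      ultimately show "poly [:of_real (1 / D):] w * (1 / (1 - h w)) = 1 / d w"
        by simp
    qed
  qed
  have g: "poly_approx A (\<lambda>w. 1 - of_real s * g w)"
  proof -
    have "poly_approx A (\<lambda>w. poly 1 w + poly [:of_real (s * p), - of_real s:] w * (1 / d w))"
      by (intro poly_approx_add poly_approx_mult bA inv_d poly_approx_poly)
    then show ?thesis
      by (rule iffD1[OF poly_approx_cong, rotated]) (simp add: g_def algebra_simps diff_divide_distrib)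
  qed
  have "r < 1" unfolding r_def using pos by simp
  then have "poly_approx A (\<lambda>w. 1 / (1 - (1 - of_real s * g w)))"
    using r by (intro poly_approx_neumann[OF bA g])
  then have "poly_approx A (\<lambda>w. poly [:of_real s:] w * (1 / d w) * (1 / (1 - (1 - of_real s * g w))))"
    by (intro poly_approx_mult bA inv_d poly_approx_poly)
  then show ?thesis
  proof (rule iffD1[OF poly_approx_cong, rotated])
    fix w assume "w \<in> A"
    then have "d w \<noteq> 0" using d[OF \<open>w \<in> A\<close>] \<epsilon> by auto
    then show "poly [:of_real s:] w * (1 / d w) * (1 / (1 - (1 - of_real s * g w))) = 1 / (w - of_real p)"
      using pos by (simp add: g_def)
  qed
qed

lemma poly_approx_rational:
  fixes \<sigma> a b \<eta> :: real
  assumes \<sigma>: "\<sigma> = 1 \<or> \<sigma> = -1" and a: "\<bar>a\<bar> > 1" and \<eta>: "\<eta> > 0"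
  shows "poly_approx {w. norm w = 1 \<and> \<eta> \<le> 1 + \<sigma> * Re w}
    (\<lambda>w. (1 + of_real b * w) / (1 + of_real a * w))"
proof -
  let ?A = "{w. norm w = 1 \<and> \<eta> \<le> 1 + \<sigma> * Re w}"
  have "bounded ?A" unfolding bounded_iff by (auto intro: exI[of _ 1])
  moreover have "poly_approx ?A (\<lambda>w. 1 / (w - of_real (- 1 / a)))"
    using assms by (intro poly_approx_cauchy_kernel) auto
  ultimately have "poly_approx ?A (\<lambda>w. poly [:of_real (1 / a), of_real (b / a):] w * (1 / (w - of_real (- 1 / a))))"
    by (intro poly_approx_mult poly_approx_poly)
  then show ?thesis
  proof (rule iffD1[OF poly_approx_cong, rotated])
    fix w :: complex
    have "w - of_real (- 1 / a) = (1 + of_real a * w) / of_real a"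
      using a by (auto simp: field_simps)
    moreover have "poly [:of_real (1 / a), of_real (b / a):] w = (1 + of_real b * w) / of_real a"
      using a by (auto simp: field_simps)
    ultimately show "poly [:of_real (1 / a), of_real (b / a):] w * (1 / (w - of_real (- 1 / a)))
        = (1 + of_real b * w) / (1 + of_real a * w)"
      using a by simp
  qed
qed

section \<open>Anticausal kernels with a rational Z-transform\<close>

text \<open>
  A nonzero power series has isolated zeros.
\<close>

lemma powser_unique:
  fixes a b :: "nat \<Rightarrow> 'a :: {real_normed_field, banach}"
  assumes "r > 0"
    and a: "\<And>z. norm z < r \<Longrightarrow> (\<lambda>n. a n * z ^ n) sums f z"
    and b: "\<And>z. norm z < r \<Longrightarrow> (\<lambda>n. b n * z ^ n) sums f z"
  shows "a = b"
proof (rule ext, rule ccontr)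
  fix n assume ne: "a n \<noteq> b n"
  have z: "(\<lambda>n. (a n - b n) * (z - 0) ^ n) sums 0" if "norm (z - 0) < r" for z
    using sums_diff[OF a[of z] b[of z]] that by (simp add: left_diff_distrib)
  have "a 0 - b 0 = 0"
    using z[of 0] \<open>r > 0\<close> sums_unique2[OF powser_sums_zero] by simp
  with ne have "n > 0" by (cases n) auto
  show False
  proof (rule powser_0_nonzero[OF \<open>r > 0\<close> z _ _ \<open>n > 0\<close>])
    show "a n - b n \<noteq> 0" using ne by simp
    fix s :: real
    assume "0 < s" and nz: "\<And>z::'a. z \<in> cball 0 s - {0} \<Longrightarrow> (0::'a) \<noteq> 0"
    show False using nz[of "of_real s"] \<open>0 < s\<close> by simp
  qed simp_all
qed

lemma sums_rational:
  fixes a b z :: complex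
  assumes "norm z < norm a"
  shows "(\<lambda>n. (of_bool (n = 0) + (b - a) / a * (- 1 / a) ^ n) * z ^ n) sums ((z + b) / (z + a))"
proof -
  have ne: "a \<noteq> 0" "z + a \<noteq> 0"
    using assms by (auto simp: add_eq_0_iff)
  have "(\<lambda>n. (- z / a) ^ n) sums (1 / (1 - (- z / a)))"
    using assms ne by (intro geometric_sums) (simp add: norm_divide divide_less_eq)
  then have "(\<lambda>n. (b - a) / a * (- z / a) ^ n) sums ((b - a) / a * (1 / (1 - (- z / a))))"
    by (rule sums_mult)
  from sums_add[OF powser_sums_if[of 0 z] this]
  have "(\<lambda>n. (if n = 0 then 1 else 0) * z ^ n + (b - a) / a * (- z / a) ^ n)
      sums (z ^ 0 + (b - a) / a * (1 / (1 - (- z / a))))" .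
  moreover have "z ^ 0 + (b - a) / a * (1 / (1 - (- z / a))) = (z + b) / (z + a)"
  proof -
    have "1 - (- z / a) = (z + a) / a"
      using ne by (simp add: field_simps)
    then have "(b - a) / a * (1 / (1 - (- z / a))) = (b - a) / (z + a)"
      using ne by simp
    then show ?thesis
      using ne by (simp add: divide_simps add.commute)
  qed
  moreover have "(if n = 0 then 1 else 0) * z ^ n + (b - a) / a * (- z / a) ^ n
      = (of_bool (n = 0) + (b - a) / a * (- 1 / a) ^ n) * z ^ n" for n
  proof -
    have "- z / a = (- 1 / a) * z" by simp
    then have "(- z / a) ^ n = (- 1 / a) ^ n * z ^ n"
      by (simp only: power_mult_distrib)
    then show ?thesis
      by (simp only: distrib_right mult.assoc of_bool_def)
  qed
  ultimately show ?thesis by simp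
qed

lemma ztransform_anticausal_sums:
  assumes "k \<in> ell_inf" and neg: "\<And>t. t > 0 \<Longrightarrow> k t = 0" and "norm z < 1"
  shows "(\<lambda>n. k (- int n) * z ^ n) sums ztransform k z"
proof -
  obtain B where B: "norm (k t) \<le> B" for t
    using assms(1) unfolding ell_inf_def bounded_iff by auto
  have "summable (\<lambda>n. norm (k (- int n) * z ^ n))"
  proof (rule summable_comparison_test')
    show "summable (\<lambda>n. B * norm z ^ n)"
      using assms(3) by (intro summable_mult summable_geometric) simp
    show "norm (norm (k (- int n) * z ^ n)) \<le> B * norm z ^ n" for n
      using B by (auto simp: norm_mult norm_power intro: mult_right_mono)
  qed
  then have "((\<lambda>n. k (- int n) * z ^ n) has_sum (\<Sum>n. k (- int n) * z ^ n)) UNIV"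
    by (intro norm_summable_imp_has_sum summable_sums summable_norm_cancel[of "\<lambda>n. k (- int n) * z ^ n"])
  moreover have "(\<lambda>n. k (- int n) * z ^ n) = (\<lambda>t. k t * z powi (- t)) \<circ> (\<lambda>n. - int n)"
    by (auto simp: fun_eq_iff)
  ultimately have "((\<lambda>t. k t * z powi (- t)) has_sum (\<Sum>n. k (- int n) * z ^ n)) (range (\<lambda>n. - int n))"
    by (subst has_sum_reindex) (auto simp: inj_on_def)
  moreover have "t \<in> range (\<lambda>n. - int n)" if "t \<le> 0" for t
    using that by (intro image_eqI[of _ _ "nat (- t)"]) auto
  ultimately have "((\<lambda>t. k t * z powi (- t)) has_sum (\<Sum>n. k (- int n) * z ^ n)) UNIV"
    by (subst (asm) has_sum_cong_neutral[where T = UNIV and g = "\<lambda>t. k t * z powi (- t)"])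
       (use neg in \<open>auto simp: not_le[symmetric]\<close>)
  then have "ztransform k z = (\<Sum>n. k (- int n) * z ^ n)"
    unfolding ztransform_def by (rule infsumI)
  then show ?thesis
    using \<open>summable (\<lambda>n. norm (k (- int n) * z ^ n))\<close> by (simp add: summable_norm_cancel summable_sums)
qed

text \<open>
  The representation of the Z-transform is given on the open disc only. Comparing Taylor coefficients there with
  those of the rational function, whose pole \<open>- a\<close> is outside the closed disc, shows that the kernel decays
  geometrically; so the representation extends to the unit circle.
\<close>

lemma anticausal_kernel_expansion:
  assumes "k \<in> anticausal_kernels"
  obtains a b :: real where "\<bar>a\<bar> > 1"
    and "summable (\<lambda>n. norm (k (- int n)))"
    and "\<And>z. norm z = 1 \<Longrightarrow> (\<lambda>n. k (- int n) * z ^ n) sums ((z + of_real b) / (z + of_real a))"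
proof -
  obtain a b :: real where ab: "a \<in> {..<-1} \<union> {1<..}"
      "\<And>z. norm z < 1 \<Longrightarrow> ztransform k z = (z + of_real b) / (z + of_real a)"
    and k: "k \<in> ell_inf" "\<And>t. t > 0 \<Longrightarrow> k t = 0"
    using assms unfolding anticausal_kernels_def by blast
  define d :: "nat \<Rightarrow> complex"
    where "d n = of_bool (n = 0) + (of_real b - of_real a) / of_real a * (- 1 / of_real a) ^ n" for n
  have a: "\<bar>a\<bar> > 1" using ab(1) by auto
  have d: "(\<lambda>n. d n * z ^ n) sums ((z + of_real b) / (z + of_real a))" if "norm z < \<bar>a\<bar>" for z
    unfolding d_def using that by (intro sums_rational) simp
  have kd: "(\<lambda>n. k (- int n)) = d"
  proof (rule powser_unique[of 1])
    show "(\<lambda>n. k (- int n) * z ^ n) sums ztransform k z" if "norm z < 1" for z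
      using k that by (intro ztransform_anticausal_sums)
    show "(\<lambda>n. d n * z ^ n) sums ztransform k z" if "norm z < 1" for z
      using d[of z] ab(2)[OF that] that a by simp
  qed simp
  have "summable (\<lambda>n. norm (d n))"
  proof (rule summable_comparison_test')
    show "summable (\<lambda>n. of_bool (n = 0) + norm ((b - a) / a) * \<bar>1 / a\<bar> ^ n)"
      using a sums_summable[OF powser_sums_if[of 0 "1::real"]]
      by (intro summable_add summable_mult summable_geometric) (auto simp: of_bool_def)
    show "norm (norm (d n)) \<le> of_bool (n = 0) + norm ((b - a) / a) * \<bar>1 / a\<bar> ^ n" for n
    proof -
      have "norm ((of_real b - of_real a) / of_real a * (- 1 / of_real a :: complex) ^ n)
          = norm ((b - a) / a) * \<bar>1 / a\<bar> ^ n"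
        by (simp add: norm_mult norm_divide norm_power power_abs flip: of_real_diff)
      then show ?thesis
        unfolding d_def by (simp add: norm_triangle_le)
    qed
  qed
  then show thesis
    using d a by (intro that[of a b]) (simp_all add: kd fun_cong[OF kd])
qed

section \<open>Predictors with finite impulse response\<close>

text \<open>
  The finite impulse response whose transfer function is the polynomial \<open>p\<close> in \<open>1/z\<close>.
\<close>

definition fir :: "complex poly \<Rightarrow> cseq" where
  "fir p t = (if t < 0 then 0 else coeff p (nat t))"

lemma fir_of_nat [simp]: "fir p (int n) = coeff p n"
  by (simp add: fir_def)

lemma has_sum_fir:
  "((\<lambda>t. fir p t * g t) has_sum (\<Sum>n\<le>degree p. coeff p n * g (int n))) UNIV"
proof -
  have "((\<lambda>t. fir p t * g t) has_sum (\<Sum>t\<in>int ` {..degree p}. fir p t * g t)) (int ` {..degree p})"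
    by (intro has_sum_finite) simp
  moreover have "fir p t = 0" if "t \<notin> int ` {..degree p}" for t
  proof (cases "t < 0")
    case False
    then have "nat t > degree p" using that by (metis atMost_iff image_eqI int_nat_eq linorder_not_less)
    then show ?thesis using False by (simp add: fir_def coeff_eq_0)
  qed (simp add: fir_def)
  ultimately have "((\<lambda>t. fir p t * g t) has_sum (\<Sum>t\<in>int ` {..degree p}. fir p t * g t)) UNIV"
    by (subst (asm) has_sum_cong_neutral[where T = UNIV and g = "\<lambda>t. fir p t * g t"]) auto
  then show ?thesis
    by (simp add: sum.reindex)
qed

lemma ztransform_fir: "ztransform (fir p) z = poly p (1 / z)"
proof -
  have "z powi (- int n) = (1 / z) ^ n" for n
    by (simp add: power_int_minus power_one_over inverse_eq_divide)
  then show ?thesis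
    by (simp only: ztransform_def infsumI[OF has_sum_fir] poly_altdef)
qed

lemma fir_predicting: "fir p \<in> predicting_kernels"
proof -
  obtain B where B: "norm (poly p w) \<le> B" if "norm w \<le> 1" for w
  proof -
    have "bounded (poly p ` cball 0 1)"
      by (rule bounded_poly_image) simp
    then obtain B where "\<forall>y\<in>poly p ` cball 0 1. norm y \<le> B"
      unfolding bounded_iff by blast
    then show ?thesis
      by (intro that[of B]) simp
  qed
  have zB: "norm (ztransform (fir p) z) \<le> B" if "norm z > 1" for z
    using that by (intro B[of "1 / z", folded ztransform_fir]) (auto simp: norm_divide divide_le_eq_1)
  have "bounded (coeff p ` {..degree p} \<union> {0})"
    by (simp add: finite_imp_bounded)
  moreover have "range (fir p) \<subseteq> coeff p ` {..degree p} \<union> {0}"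
    by (auto simp: fir_def) (metis atMost_iff coeff_eq_0 image_eqI linorder_not_less)
  ultimately have "bounded (range (fir p))"
    by (rule bounded_subset)
  then have "fir p \<in> ell_inf_plus"
    by (simp add: ell_inf_plus_def ell_inf_def fir_def)
  moreover have hol: "holomorphic_exterior (ztransform (fir p))"
    unfolding holomorphic_exterior_def ztransform_fir by (intro exI[of _ "poly p"] conjI holomorphic_intros) auto
  moreover have "bounded (ztransform (fir p) ` {z. norm z > 1})"
    unfolding bounded_iff using zB by (intro exI[of _ B]) auto
  moreover have "bdd_above ((\<lambda>\<rho>. integral {-pi..pi} (\<lambda>\<omega>. norm (ztransform (fir p) (of_real \<rho> * cis \<omega>)) powr 2)) ` {1<..})"
  proof (rule bdd_aboveI2)
    fix \<rho> :: real assume \<rho>: "\<rho> \<in> {1<..}"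
    have "integral {-pi..pi} (\<lambda>\<omega>. norm (ztransform (fir p) (of_real \<rho> * cis \<omega>)) powr 2)
        \<le> integral {-pi..pi} (\<lambda>\<omega>. B\<^sup>2)"
    proof (rule integral_le)
      show "(\<lambda>\<omega>. norm (ztransform (fir p) (of_real \<rho> * cis \<omega>)) powr 2) integrable_on {-pi..pi}"
        unfolding ztransform_fir powr_numeral[OF norm_ge_zero] using \<rho>
        by (intro integrable_continuous_interval continuous_intros) auto
      show "norm (ztransform (fir p) (of_real \<rho> * cis \<omega>)) powr 2 \<le> B\<^sup>2" for \<omega>
        unfolding powr_numeral[OF norm_ge_zero] using \<rho>
        by (intro power_mono zB) (auto simp: norm_mult)
    qed auto
    then show "integral {-pi..pi} (\<lambda>\<omega>. norm (ztransform (fir p) (of_real \<rho> * cis \<omega>)) powr 2) \<le> 2 * pi * B\<^sup>2"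
      by simp
  qed
  ultimately show ?thesis
    unfolding predicting_kernels_def Hardy_inf_def Hardy_def by simp
qed

section \<open>The error of prediction\<close>

lemma has_sum_past_conv_fir:
  "((\<lambda>s. fir p (t - s) * x s) has_sum (\<Sum>n\<le>degree p. coeff p n * x (t - int n))) {..t}"
proof -
  have "((\<lambda>j. fir p j * x (t - j)) has_sum (\<Sum>n\<le>degree p. coeff p n * x (t - int n))) {0..}"
    using has_sum_fir[of p "\<lambda>j. x (t - j)"]
    by (subst has_sum_cong_neutral[where T = UNIV and g = "\<lambda>j. fir p j * x (t - j)"]) (auto simp: fir_def)
  then show ?thesis
    by (rule iffD1[OF has_sum_reindex_bij_witness[of _ "\<lambda>s. t - s" "\<lambda>j. t - j"], rotated -1]) auto
qed

lemma future_conv_sums: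
  assumes "summable (\<lambda>n. norm (k (- int n)))" and "bounded (range x)"
  shows "(\<lambda>s. k (t - s) * x s) summable_on {t..}"
    and "(\<lambda>n. k (- int n) * x (t + int n)) sums future_conv k x t"
proof -
  obtain B where B: "norm (x t) \<le> B" for t
    using assms(2) unfolding bounded_iff by auto
  have "summable (\<lambda>n. norm (k (- int n) * x (t + int n)))"
  proof (rule summable_comparison_test')
    show "summable (\<lambda>n. norm (k (- int n)) * B)"
      by (intro summable_mult2 assms)
  qed (use B in \<open>auto simp: norm_mult intro: mult_left_mono\<close>)
  then have sums: "(\<lambda>n. k (- int n) * x (t + int n)) sums (\<Sum>n. k (- int n) * x (t + int n))"
    and hs: "((\<lambda>n. k (- int n) * x (t + int n)) has_sum (\<Sum>n. k (- int n) * x (t + int n))) UNIV"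
    by (auto intro!: norm_summable_imp_has_sum summable_sums dest: summable_norm_cancel)
  have hs': "((\<lambda>s. k (t - s) * x s) has_sum (\<Sum>n. k (- int n) * x (t + int n))) {t..}"
    using hs
    by (rule iffD1[OF has_sum_reindex_bij_witness[of _ "\<lambda>s. nat (s - t)" "\<lambda>n. t + int n"], rotated -1]) auto
  then show "(\<lambda>s. k (t - s) * x s) summable_on {t..}"
    by (rule has_sum_imp_summable)
  show "(\<lambda>n. k (- int n) * x (t + int n)) sums future_conv k x t"
    using sums infsumI[OF hs'] by (simp add: future_conv_def)
qed

lemma sum_split_sign:
  fixes u v :: "int \<Rightarrow> complex"
  assumes "\<And>j. j > 0 \<Longrightarrow> u j = 0" and "\<And>j. j < 0 \<Longrightarrow> v j = 0"
  shows "(\<Sum>j\<in>{- int M..int D}. u j - v j) = (\<Sum>n\<le>M. u (- int n)) - (\<Sum>n\<le>D. v (int n))"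
proof -
  have "(\<Sum>j\<in>{- int M..int D}. u j) = (\<Sum>j\<in>{- int M..0}. u j)"
    by (rule sum.mono_neutral_right) (use assms in auto)
  also have "\<dots> = (\<Sum>n\<le>M. u (- int n))"
    by (rule sum.reindex_bij_witness[of _ "\<lambda>n. - int n" "\<lambda>j. nat (- j)"]) auto
  finally have u: "(\<Sum>j\<in>{- int M..int D}. u j) = (\<Sum>n\<le>M. u (- int n))" .
  have "(\<Sum>j\<in>{- int M..int D}. v j) = (\<Sum>j\<in>{0..int D}. v j)"
    by (rule sum.mono_neutral_right) (use assms in auto)
  also have "\<dots> = (\<Sum>n\<le>D. v (int n))"
    by (rule sum.reindex_bij_witness[of _ int nat]) auto
  finally show ?thesis using u by (simp add: sum_subtractf)
qed

text \<open>
  The error of the prediction is the output of the two-sided filter \<open>k - fir p\<close>. Cutting off the tail of \<open>k\<close>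
  makes this filter finite and changes its frequency response by at most \<open>r M\<close>, a tail of a convergent
  series.
\<close>

lemma prediction_error_bound:
  assumes kpos: "\<And>t. t > 0 \<Longrightarrow> k t = 0" and ksum: "summable (\<lambda>n. norm (k (- int n)))"
    and K: "\<And>\<omega>. (\<lambda>n. k (- int n) * cis \<omega> ^ n) sums K \<omega>"
    and x: "bounded (range x)" "has_ztransform_circle x X"
    and supp: "AE \<omega> in circle_measure. \<omega> \<notin> S \<longrightarrow> X \<omega> = 0"
    and \<beta>: "\<And>\<omega>. \<omega> \<in> S \<Longrightarrow> norm (K \<omega> - poly p (cis (- \<omega>))) \<le> \<beta>"
    and F: "finite F"
  shows "(\<Sum>t\<in>F. (norm (future_conv k x t - past_conv (fir p) x t))\<^sup>2)
    \<le> \<beta>\<^sup>2 / pi * (LINT \<omega>|circle_measure. (norm (X \<omega>))\<^sup>2)"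
proof -
  define J where "J M = {- int M..int (degree p)}" for M
  define h where "h j = k j - fir p j" for j
  define r where "r M = (\<Sum>n. norm (k (- int n))) - (\<Sum>n\<le>M. norm (k (- int n)))" for M
  have conv: "(\<Sum>j\<in>J M. h j * x (t - j)) = (\<Sum>n\<le>M. k (- int n) * x (t + int n)) - past_conv (fir p) x t" for M t
    using sum_split_sign[of "\<lambda>j. k j * x (t - j)" "\<lambda>j. fir p j * x (t - j)" M "degree p"] kpos
      infsumI[OF has_sum_past_conv_fir[of p t x]]
    by (simp add: J_def h_def left_diff_distrib past_conv_def fir_def)
  have sym: "norm (symbol (J M) h \<omega>) \<le> \<beta> + r M" if "\<omega> \<in> S" for M \<omega>
  proof -
    have e: "cis \<omega> powi (- int n) = cis (- \<omega>) ^ n" for n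
      by (simp add: cis_power_int Complex.DeMoivre)
    have "symbol (J M) h \<omega> = (\<Sum>n\<le>M. k (- int n) * cis \<omega> ^ n) - poly p (cis (- \<omega>))"
      using sum_split_sign[of "\<lambda>j. k j * cis \<omega> powi (- j)" "\<lambda>j. fir p j * cis \<omega> powi (- j)" M "degree p"] kpos
      by (simp add: symbol_def J_def h_def left_diff_distrib fir_def poly_altdef e)
    also have "\<dots> = (K \<omega> - poly p (cis (- \<omega>))) - (K \<omega> - (\<Sum>n\<le>M. k (- int n) * cis \<omega> ^ n))"
      by simp
    also have "norm \<dots> \<le> norm (K \<omega> - poly p (cis (- \<omega>))) + norm (K \<omega> - (\<Sum>n\<le>M. k (- int n) * cis \<omega> ^ n))"
      by (rule norm_triangle_ineq4)
    also have "K \<omega> - (\<Sum>n\<le>M. k (- int n) * cis \<omega> ^ n) = (\<Sum>n. k (- int (n + Suc M)) * cis \<omega> ^ (n + Suc M))"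
      using suminf_minus_initial_segment[OF sums_summable[OF K[of \<omega>]], of "Suc M"] sums_unique[OF K[of \<omega>]]
      by (simp add: lessThan_Suc_atMost)
    also have "norm \<dots> \<le> (\<Sum>n. norm (k (- int (n + Suc M)) * cis \<omega> ^ (n + Suc M)))"
      using summable_ignore_initial_segment[OF ksum, of "Suc M"]
      by (intro summable_norm) (simp add: norm_mult norm_power)
    also have "\<dots> = (\<Sum>n. norm (k (- int (n + Suc M))))"
      by (simp add: norm_mult norm_power)
    also have "\<dots> = r M"
      using suminf_minus_initial_segment[OF ksum, of "Suc M"] by (simp add: r_def lessThan_Suc_atMost)
    finally show ?thesis using \<beta>[OF that] by linarith
  qed
  have "(\<lambda>M. r M) \<longlonglongrightarrow> (\<Sum>n. norm (k (- int n))) - (\<Sum>n. norm (k (- int n)))"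
    unfolding r_def using summable_LIMSEQ'[OF ksum] by (intro tendsto_intros)
  then have "r \<longlonglongrightarrow> 0" by simp
  have "(\<lambda>M. \<Sum>t\<in>F. (norm ((\<Sum>n\<le>M. k (- int n) * x (t + int n)) - past_conv (fir p) x t))\<^sup>2)
     \<longlonglongrightarrow> (\<Sum>t\<in>F. (norm (future_conv k x t - past_conv (fir p) x t))\<^sup>2)"
    using future_conv_sums(2)[OF ksum x(1)] unfolding sums_def_le by (intro tendsto_intros) auto
  moreover have "(\<lambda>M. (\<beta> + r M)\<^sup>2 / pi * (LINT \<omega>|circle_measure. (norm (X \<omega>))\<^sup>2))
      \<longlonglongrightarrow> (\<beta> + 0)\<^sup>2 / pi * (LINT \<omega>|circle_measure. (norm (X \<omega>))\<^sup>2)"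
    by (intro tendsto_intros \<open>r \<longlonglongrightarrow> 0\<close>) simp
  moreover have "(\<Sum>t\<in>F. (norm ((\<Sum>n\<le>M. k (- int n) * x (t + int n)) - past_conv (fir p) x t))\<^sup>2)
      \<le> (\<beta> + r M)\<^sup>2 / pi * (LINT \<omega>|circle_measure. (norm (X \<omega>))\<^sup>2)" for M
    unfolding conv[symmetric]
    by (rule finite_convolution_bound[OF _ x(2) supp sym F]) (simp add: J_def)
  ultimately have "(\<Sum>t\<in>F. (norm (future_conv k x t - past_conv (fir p) x t))\<^sup>2)
      \<le> (\<beta> + 0)\<^sup>2 / pi * (LINT \<omega>|circle_measure. (norm (X \<omega>))\<^sup>2)"
    by (intro LIMSEQ_le) auto
  then show ?thesis by simp
qed

text \<open>
  With \<open>w = cis (- \<omega>)\<close>, the transfer function of \<open>k\<close> is \<open>R w = (1 + b w) / (1 + a w)\<close>, and a predictor is a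
  polynomial in \<open>w\<close>. The sign \<open>\<sigma> = 1\<close> serves spectra that avoid a neighbourhood of \<open>- 1\<close>, that is low-pass
  processes, and \<open>\<sigma> = -1\<close> serves high-pass ones. The polynomials are chosen before the process; the process
  affects only the constant \<open>C\<close>.
\<close>

lemma band_predictors:
  fixes \<sigma> \<eta> :: real
  assumes k: "k \<in> anticausal_kernels" and \<sigma>: "\<sigma> = 1 \<or> \<sigma> = -1" and \<eta>: "\<eta> > 0"
  shows "\<exists>p. \<forall>x X. bounded (range x) \<longrightarrow> has_ztransform_circle x X \<longrightarrow>
    (AE \<omega> in circle_measure. 1 + \<sigma> * cos \<omega> < \<eta> \<longrightarrow> X \<omega> = 0) \<longrightarrow>
    (\<exists>C. \<forall>m F. finite F \<longrightarrow>
      (\<Sum>t\<in>F. (norm (future_conv k x t - past_conv (fir (p m)) x t))\<^sup>2) \<le> C / (real (Suc m))\<^sup>2)"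
proof -
  obtain a b :: real where a: "\<bar>a\<bar> > 1" and ksum: "summable (\<lambda>n. norm (k (- int n)))"
    and K: "\<And>z. norm z = 1 \<Longrightarrow> (\<lambda>n. k (- int n) * z ^ n) sums ((z + of_real b) / (z + of_real a))"
    using anticausal_kernel_expansion[OF k] by blast
  have kpos: "k t = 0" if "t > 0" for t
    using k that by (auto simp: anticausal_kernels_def)
  define R :: "complex \<Rightarrow> complex" where "R w = (1 + of_real b * w) / (1 + of_real a * w)" for w
  have KR: "(\<lambda>n. k (- int n) * cis \<omega> ^ n) sums R (cis (- \<omega>))" for \<omega>
  proof -
    have "cis \<omega> * cis (- \<omega>) = 1" by (simp add: cis_mult)
    then have "R (cis (- \<omega>)) = ((cis \<omega> + of_real b) * cis (- \<omega>)) / ((cis \<omega> + of_real a) * cis (- \<omega>))"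
      by (simp add: R_def distrib_right)
    also have "\<dots> = (cis \<omega> + of_real b) / (cis \<omega> + of_real a)"
      by simp
    finally show ?thesis using K[of "cis \<omega>"] by simp
  qed
  have "\<exists>p. \<forall>w\<in>{w. norm w = 1 \<and> \<eta> \<le> 1 + \<sigma> * Re w}. norm (R w - poly p w) < 1 / real (Suc m)" for m
    using poly_approx_rational[OF \<sigma> a \<eta>, of b] unfolding poly_approx_def R_def by simp
  then have "\<forall>m. \<exists>p. \<forall>w\<in>{w. norm w = 1 \<and> \<eta> \<le> 1 + \<sigma> * Re w}. norm (R w - poly p w) < 1 / real (Suc m)" ..
  from choice[OF this]
  obtain p where p: "\<And>m w. norm w = 1 \<Longrightarrow> \<eta> \<le> 1 + \<sigma> * Re w \<Longrightarrow> norm (R w - poly (p m) w) < 1 / real (Suc m)"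
    by blast
  show ?thesis
  proof (intro exI[of _ p] allI impI)
    fix x X assume x: "bounded (range x)" "has_ztransform_circle x X"
      and supp: "AE \<omega> in circle_measure. 1 + \<sigma> * cos \<omega> < \<eta> \<longrightarrow> X \<omega> = 0"
    let ?S = "{\<omega>. \<eta> \<le> 1 + \<sigma> * cos \<omega>}"
    have "(\<Sum>t\<in>F. (norm (future_conv k x t - past_conv (fir (p m)) x t))\<^sup>2)
       \<le> (1 / real (Suc m))\<^sup>2 / pi * (LINT \<omega>|circle_measure. (norm (X \<omega>))\<^sup>2)" if "finite F" for m F
    proof (rule prediction_error_bound[OF kpos ksum KR x _ _ that])
      show "AE \<omega> in circle_measure. \<omega> \<notin> ?S \<longrightarrow> X \<omega> = 0"
        using supp by (simp add: not_le not_less)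
      show "norm (R (cis (- \<omega>)) - poly (p m) (cis (- \<omega>))) \<le> 1 / real (Suc m)" if "\<omega> \<in> ?S" for \<omega>
        using that by (intro less_imp_le[OF p]) auto
    qed
    then show "\<exists>C. \<forall>m F. finite F \<longrightarrow>
      (\<Sum>t\<in>F. (norm (future_conv k x t - past_conv (fir (p m)) x t))\<^sup>2) \<le> C / (real (Suc m))\<^sup>2"
      by (intro exI[of _ "(LINT \<omega>|circle_measure. (norm (X \<omega>))\<^sup>2) / pi"]) (simp add: power_divide mult.commute)
  qed
qed

section \<open>Convergence of the predictions\<close>

lemma ell2_bounded:
  assumes "x \<in> ell 2" shows "bounded (range x)"
proof -
  have s: "(\<lambda>t. (norm (x t))\<^sup>2) summable_on UNIV"
    using assms by (simp add: ell_def)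
  have "norm (x t) \<le> sqrt (\<Sum>\<^sub>\<infinity>t. (norm (x t))\<^sup>2)" for t
    using finite_sum_le_infsum[OF s, of "{t}"] by (intro real_le_rsqrt) simp
  then show ?thesis unfolding bounded_iff by auto
qed

text \<open>
  Bounds on finite windows suffice, since the terms of the sum are nonnegative; they also give the membership in
  \<open>ell 2\<close>.
\<close>

lemma tends_in_ell2I:
  assumes b: "\<And>m F. finite F \<Longrightarrow> (\<Sum>t\<in>F. (norm (u t - v m t))\<^sup>2) \<le> B m" and "B \<longlonglongrightarrow> 0"
  shows "tends_in_ell 2 v u"
proof -
  have s: "(\<lambda>t. (norm (u t - v m t))\<^sup>2) summable_on UNIV" for m
    using b[of _ m] by (intro nonneg_bdd_above_summable_on bdd_aboveI2[of _ _ "B m"]) auto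
  have le: "(\<Sum>\<^sub>\<infinity>t. (norm (u t - v m t))\<^sup>2) \<le> B m" for m
    using b[of _ m] s by (intro infsum_le_finite_sums) auto
  have n: "ell_norm 2 (\<lambda>t. u t - v m t) = sqrt (\<Sum>\<^sub>\<infinity>t. (norm (u t - v m t))\<^sup>2)" for m
    by (simp add: ell_norm_def powr_half_sqrt infsum_nonneg)
  have "(\<lambda>m. ell_norm 2 (\<lambda>t. u t - v m t)) \<longlonglongrightarrow> 0"
    unfolding n
  proof (rule tendsto_sandwich[where f = "\<lambda>_. 0" and h = "\<lambda>m. sqrt (B m)"])
    show "(\<lambda>m. sqrt (B m)) \<longlonglongrightarrow> 0"
      using tendsto_real_sqrt[OF assms(2)] by simp
  qed (use le in \<open>simp_all add: infsum_nonneg\<close>)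
  moreover have "(\<lambda>t. u t - v m t) \<in> ell 2" for m
    using s[of m] by (simp add: ell_def)
  ultimately show ?thesis
    by (simp add: tends_in_ell_def)
qed

theorem corollary1:
  fixes \<Omega> :: real and k :: "int \<Rightarrow> complex"
  assumes "0 < \<Omega>" and "\<Omega> < pi" and "k \<in> anticausal_kernels"
  shows "\<exists>kL kH :: nat \<Rightarrow> int \<Rightarrow> complex.
    (\<forall>m\<ge>1. kL m \<in> predicting_kernels \<and> kH m \<in> predicting_kernels) \<and>
    (\<forall>x xL xH :: int \<Rightarrow> complex.
      xL \<in> low_band \<Omega> \<longrightarrow> xH \<in> high_band \<Omega> \<longrightarrow> (\<forall>t. x t = xL t + xH t) \<longrightarrow>
      (let y = future_conv k x;
           yL = future_conv k xL;
           yH = future_conv k xH;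
           yhatL = (\<lambda>m. past_conv (kL m) xL);
           yhatH = (\<lambda>m. past_conv (kH m) xH);
           yhat = (\<lambda>m t. yhatL m t + yhatH m t)
       in future_conv_defined k x \<and> future_conv_defined k xL \<and> future_conv_defined k xH \<and>
          (\<forall>m\<ge>1. past_conv_defined (kL m) xL \<and> past_conv_defined (kH m) xH) \<and>
          tends_in_ell 2 yhatL yL \<and>
          tends_in_ell 2 yhatH yH \<and>
          tends_in_ell 2 yhat y))"
proof -
  let ?err = "\<lambda>x p m F. \<Sum>t\<in>F. (norm (future_conv k x t - past_conv (fir (p m)) x t))\<^sup>2"
  have ksum: "summable (\<lambda>n. norm (k (- int n)))"
    using anticausal_kernel_expansion[OF assms(3)] by blast
  have "0 < 1 + cos \<Omega>" "0 < 1 - cos \<Omega>"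
    using cos_monotone_0_pi[of \<Omega> pi] cos_monotone_0_pi[of 0 \<Omega>] assms(1,2) by auto
  note eta = this
  obtain pL where
    pL: "\<And>x X. bounded (range x) \<Longrightarrow> has_ztransform_circle x X \<Longrightarrow>
      (AE \<omega> in circle_measure. cos \<omega> < cos \<Omega> \<longrightarrow> X \<omega> = 0) \<Longrightarrow>
      \<exists>C. \<forall>m F. finite F \<longrightarrow> ?err x pL m F \<le> C / (real (Suc m))\<^sup>2"
    using band_predictors[OF assms(3) _ eta(1), of 1] by (auto simp del: of_nat_Suc)
  obtain pH where
    pH: "\<And>x X. bounded (range x) \<Longrightarrow> has_ztransform_circle x X \<Longrightarrow>
      (AE \<omega> in circle_measure. cos \<Omega> < cos \<omega> \<longrightarrow> X \<omega> = 0) \<Longrightarrow>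
      \<exists>C. \<forall>m F. finite F \<longrightarrow> ?err x pH m F \<le> C / (real (Suc m))\<^sup>2"
    using band_predictors[OF assms(3) _ eta(2), of "-1"] by (auto simp del: of_nat_Suc)
  have circ: "AE \<omega> in circle_measure. \<bar>\<omega>\<bar> \<le> pi"
    using AE_space[of circle_measure] by (auto simp: abs_le_iff)
  have zero: "(\<lambda>m. C / (real (Suc m))\<^sup>2) \<longlonglongrightarrow> 0" for C
    by real_asymp
  have past: "past_conv_defined (fir p) x" for p x
    unfolding past_conv_defined_def using has_sum_past_conv_fir has_sum_imp_summable by blast
  show ?thesis
    unfolding Let_def
  proof (rule exI[of _ "\<lambda>m. fir (pL m)"], rule exI[of _ "\<lambda>m. fir (pH m)"], intro conjI allI impI)
    fix x xL xH :: cseq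
    assume L: "xL \<in> low_band \<Omega>" and H: "xH \<in> high_band \<Omega>" and x: "\<forall>t. x t = xL t + xH t"
    have bL: "bounded (range xL)" and bH: "bounded (range xH)"
      using L H by (auto simp: low_band_def high_band_def intro: ell2_bounded)
    note sL = future_conv_sums(1)[OF ksum bL] and sH = future_conv_sums(1)[OF ksum bH]
    show "future_conv_defined k xL" "future_conv_defined k xH"
      using sL sH by (auto simp: future_conv_defined_def)
    show "future_conv_defined k x"
      using summable_on_add[OF sL sH] x by (simp add: future_conv_defined_def distrib_left)
    have y: "future_conv k x t = future_conv k xL t + future_conv k xH t" for t
      using infsum_add[OF sL sH] x by (simp add: future_conv_def distrib_left)
    obtain XL where XL: "has_ztransform_circle xL XL" "AE \<omega> in circle_measure. \<bar>\<omega>\<bar> > \<Omega> \<longrightarrow> XL \<omega> = 0"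
      using L by (auto simp: low_band_def)
    have "AE \<omega> in circle_measure. cos \<omega> < cos \<Omega> \<longrightarrow> XL \<omega> = 0"
      using XL(2)
    proof eventually_elim
      case (elim \<omega>)
      then show ?case
        using cos_monotone_0_pi_le[of "\<bar>\<omega>\<bar>" \<Omega>] assms by force
    qed
    then obtain CL where CL: "\<And>m F. finite F \<Longrightarrow> ?err xL pL m F \<le> CL / (real (Suc m))\<^sup>2"
      using pL[OF bL XL(1)] by blast
    obtain XH where XH: "has_ztransform_circle xH XH" "AE \<omega> in circle_measure. \<bar>\<omega>\<bar> < \<Omega> \<longrightarrow> XH \<omega> = 0"
      using H by (auto simp: high_band_def)
    have "AE \<omega> in circle_measure. cos \<Omega> < cos \<omega> \<longrightarrow> XH \<omega> = 0"
      using XH(2) circ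
    proof eventually_elim
      case (elim \<omega>)
      then show ?case
        using cos_monotone_0_pi_le[of \<Omega> "\<bar>\<omega>\<bar>"] assms by force
    qed
    then obtain CH where CH: "\<And>m F. finite F \<Longrightarrow> ?err xH pH m F \<le> CH / (real (Suc m))\<^sup>2"
      using pH[OF bH XH(1)] by blast
    show "tends_in_ell 2 (\<lambda>m. past_conv (fir (pL m)) xL) (future_conv k xL)"
      by (rule tends_in_ell2I[OF CL zero])
    show "tends_in_ell 2 (\<lambda>m. past_conv (fir (pH m)) xH) (future_conv k xH)"
      by (rule tends_in_ell2I[OF CH zero])
    show "tends_in_ell 2 (\<lambda>m t. past_conv (fir (pL m)) xL t + past_conv (fir (pH m)) xH t) (future_conv k x)"
    proof (rule tends_in_ell2I[OF _ zero])
      fix m and F :: "int set" assume F: "finite F"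
      have "(\<Sum>t\<in>F. (norm (future_conv k x t - (past_conv (fir (pL m)) xL t + past_conv (fir (pH m)) xH t)))\<^sup>2)
          \<le> (\<Sum>t\<in>F. 2 * (norm (future_conv k xL t - past_conv (fir (pL m)) xL t))\<^sup>2
             + 2 * (norm (future_conv k xH t - past_conv (fir (pH m)) xH t))\<^sup>2)"
      proof (rule sum_mono)
        fix t
        show "(norm (future_conv k x t - (past_conv (fir (pL m)) xL t + past_conv (fir (pH m)) xH t)))\<^sup>2
          \<le> 2 * (norm (future_conv k xL t - past_conv (fir (pL m)) xL t))\<^sup>2
             + 2 * (norm (future_conv k xH t - past_conv (fir (pH m)) xH t))\<^sup>2"
          using norm_sq_le_double[of "future_conv k x t - (past_conv (fir (pL m)) xL t + past_conv (fir (pH m)) xH t)"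
              "future_conv k xL t - past_conv (fir (pL m)) xL t"]
          unfolding y by (simp add: algebra_simps norm_minus_commute[of "past_conv (fir (pH m)) xH t"])
      qed
      also have "\<dots> \<le> 2 * (CL / (real (Suc m))\<^sup>2) + 2 * (CH / (real (Suc m))\<^sup>2)"
        unfolding sum.distrib sum_distrib_left[symmetric]
        using CL[OF F] CH[OF F] by (intro add_mono mult_left_mono) auto
      also have "\<dots> = (2 * CL + 2 * CH) / (real (Suc m))\<^sup>2"
        by (simp add: add_divide_distrib)
      finally show "(\<Sum>t\<in>F. (norm (future_conv k x t - (past_conv (fir (pL m)) xL t + past_conv (fir (pH m)) xH t)))\<^sup>2)
          \<le> (2 * CL + 2 * CH) / (real (Suc m))\<^sup>2" .
    qed
  qed (auto simp: fir_predicting past)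
qed

end
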